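(* For all $L\in\mathbf N$, $$G\left(L,L,\tfrac{11}{4},\tfrac{5}{2},4,q\right)\geq 0,$$ and for all integers $L\ge 1$, $$G\left(L-1,L+1,4,\tfrac{5}{4},4,q\right)\geq 0,\qquad G\left(L-1,L+1,\tfrac{15}{4},\tfrac{3}{2},4,q\right)\geq 0.$$
   Context: $\mathbf N$ denotes the set of nonnegative integers. For $m\in\mathbf N$, $(q)_m=\prod_{j=1}^m(1-q^j)$, with $(q)_0=1$. The $q$-binomial coefficient is $\begin{bmatrix} m+n\\ m\end{bmatrix}_q=\frac{(q)_{m+n}}{(q)_m(q)_n}$ if $m,n\in\mathbf N$, and it is $0$ otherwise (so $\begin{bmatrix} A\\ B\end{bmatrix}_q=0$ unless $0\le B\le A$). Define $$G(N,M,\alpha,\beta,K,q)=\sum_{j=-\infty}^\infty(-1)^j q^{Kj\frac{(\alpha+\beta)j+(\alpha-\beta)}{2}}\begin{bmatrix} N+M\\ N-Kj\end{bmatrix}_q .$$ The notation $P(q)\ge 0$ means that $P(q)$ is a polynomial in $q$ with nonnegative coefficients. *)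

theory Defs
  imports "HOL-Library.Poly_Mapping" "HOL-Computational_Algebra.Polynomial"
begin

text \<open>
  For rational \<open>\<alpha>\<close> and \<open>\<beta>\<close> the exponents of \<open>q\<close> in \<open>G\<close> are rational and
  possibly negative, so \<open>G\<close> takes values in the ring of finite integer combinations of the
  formal powers \<open>q^e\<close> with \<open>e\<close> rational.
\<close>

type_synonym qseries = "rat \<Rightarrow>\<^sub>0 int"

definition q_poly :: "int poly \<Rightarrow> qseries" where
  "q_poly p = (\<Sum>i\<le>degree p. Poly_Mapping.single (of_nat i) (coeff p i))"

definition q_factorial :: "nat \<Rightarrow> int poly" where
  "q_factorial m = (\<Prod>j=1..m. 1 - monom 1 j)"

text \<open>The division below is exact in the ring of integer polynomials.\<close>

definition q_binomial :: "int \<Rightarrow> int \<Rightarrow> int poly" where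
  "q_binomial A B =
     (if 0 \<le> B \<and> B \<le> A
      then q_factorial (nat A) div (q_factorial (nat B) * q_factorial (nat (A - B)))
      else 0)"

text \<open>
  \<open>Sum_any\<close> adds up the nonzero terms and is \<open>0\<close> if there are infinitely many of them;
  for \<open>K \<noteq> 0\<close> there are only finitely many, as the \<open>q\<close>-binomial coefficient vanishes
  for large \<open>\<bar>j\<bar>\<close>.
\<close>

definition G :: "int \<Rightarrow> int \<Rightarrow> rat \<Rightarrow> rat \<Rightarrow> int \<Rightarrow> qseries" where
  "G N M \<alpha> \<beta> K =
     Sum_any (\<lambda>j::int.
       (-1) ^ nat \<bar>j\<bar>
       * Poly_Mapping.single
           (of_int K * of_int j * (((\<alpha> + \<beta>) * of_int j + (\<alpha> - \<beta>)) / 2)) 1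
       * q_poly (q_binomial (N + M) (N - K * j)))"

definition q_nonneg :: "qseries \<Rightarrow> bool" where
  "q_nonneg P \<longleftrightarrow> (\<exists>p::int poly. P = q_poly p \<and> (\<forall>i. coeff p i \<ge> 0))"

end

theory Submission
  imports Defs Complex_Main
begin

text \<open>
  Two \<open>q\<close>-Vandermonde summations give, for \<open>e \<in> {0, 1}\<close>, a transformation with nonnegative kernel
  \<open>q\<^bsup>2j(j+e)\<^esup> [2L, L-e-2j] = \<Sum>\<^sub>r T\<^sub>e(L,r) [2r+e, r-j]\<close>.
  Let \<open>t = j(j+1)/2\<close>. Since \<open>j(21j+1)/2 = t + 2j\<^sup>2 + 2(2j)\<^sup>2\<close>, applying the transformation (with
  \<open>2j\<close> for \<open>j\<close>) reduces the first sum to Bressoud's \<open>\<Sum>\<^sub>j (-1)\<^sup>j q\<^bsup>t+2j\<^sup>2\<^esup> [2r, r-2j]\<close>; applying it once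
  more leaves \<open>\<Sum>\<^sub>j (-1)\<^sup>j q\<^sup>t [2s, s-j]\<close>, which vanishes for \<open>s > 0\<close>, so that Bressoud's sum equals
  \<open>\<Sum>\<^sub>n q\<^bsup>n\<^sup>2\<^esup> [r, n]\<close>. The other two sums reduce by \<open>e = 1\<close> to odd analogues of Bressoud's sum,
  which the \<open>q\<close>-Pascal rules bring back to the same situation.
  All identities are proved at real \<open>q > 1\<close> and lifted by evaluation at infinitely many integers.
\<close>

section \<open>Gaussian binomials at a real point\<close>

definition qfac :: "real \<Rightarrow> nat \<Rightarrow> real" where
  "qfac q n = (\<Prod>j=1..n. 1 - q ^ j)"

text \<open>Setting \<open>1 / (q)\<^sub>m = 0\<close> for negative \<open>m\<close> makes the recursion \<open>rfac_pred\<close> and hence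
  the \<open>q\<close>-Pascal rules hold without side conditions on the lower index.\<close>

definition rfac :: "real \<Rightarrow> int \<Rightarrow> real" where
  "rfac q m = (if m < 0 then 0 else 1 / qfac q (nat m))"

text \<open>For negative \<open>n\<close> the value \<open>qfac q (nat n) = 1\<close> does no harm:
  \<open>k\<close> and \<open>n - k\<close> cannot both be nonnegative, so one \<open>rfac\<close>
  factor is zero.\<close>

definition qbin :: "real \<Rightarrow> int \<Rightarrow> int \<Rightarrow> real" where
  "qbin q n k = qfac q (nat n) * rfac q k * rfac q (n - k)"

definition tri :: "int \<Rightarrow> int" where
  "tri j = j * (j + 1) div 2"

lemma tri2: "2 * tri j = j * (j + 1)"
  unfolding tri_def by simp

lemma qfac_nonzero: "1 < q \<Longrightarrow> qfac q n \<noteq> 0"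
proof -
  assume "1 < q"
  then have "1 < q ^ j" if "1 \<le> j" for j
    by (rule one_less_power) (use that in simp)
  then show ?thesis by (force simp: qfac_def)
qed

lemma qfac_Suc: "qfac q (Suc n) = qfac q n * (1 - q ^ Suc n)"
  unfolding qfac_def by simp

lemma rfac_neg [simp]: "m < 0 \<Longrightarrow> rfac q m = 0"
  by (simp add: rfac_def)

lemma rfac_0 [simp]: "rfac q 0 = 1"
  by (simp add: rfac_def qfac_def)

lemma qfac_0 [simp]: "qfac q 0 = 1"
  by (simp add: qfac_def)

lemma qfac_rfac: "1 < q \<Longrightarrow> 0 \<le> m \<Longrightarrow> qfac q (nat m) * rfac q m = 1"
  using qfac_nonzero[of q "nat m"] by (simp add: rfac_def)

lemma qfac_add1: "0 \<le> n \<Longrightarrow> qfac q (nat (n + 1)) = qfac q (nat n) * (1 - q powi (n + 1))"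
  using qfac_Suc[of q "nat n"] by (simp add: nat_add_distrib power_int_def)

lemma rfac_pred:
  assumes "1 < q"
  shows "rfac q (m - 1) = (1 - q powi m) * rfac q m"
proof (cases "m \<le> 0")
  case True
  \<comment> \<open>At m = 0 the factor 1 - q^0 vanishes, in agreement with
    \<open>rfac q (- 1) = 0\<close>.\<close>
  then show ?thesis by (cases "m = 0") auto
next
  case False
  then have "qfac q (nat m) = qfac q (nat (m - 1)) * (1 - q powi m)"
    using qfac_add1[of "m - 1" q] by simp
  then show ?thesis
    using False assms qfac_nonzero[of q "nat m"] qfac_nonzero[of q "nat (m - 1)"]
    by (simp add: rfac_def field_simps)
qed

section \<open>Boundary values, symmetry, Pascal rules and summation formulas\<close>

lemma qbin_neg [simp]: "k < 0 \<Longrightarrow> qbin q n k = 0"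
  by (simp add: qbin_def)

lemma qbin_gt [simp]: "n < k \<Longrightarrow> qbin q n k = 0"
  by (simp add: qbin_def)

lemma qbin_0_left [simp]: "k \<noteq> 0 \<Longrightarrow> qbin q 0 k = 0"
  by (cases "k < 0") simp_all

lemma qbin_0_right [simp]: "1 < q \<Longrightarrow> 0 \<le> n \<Longrightarrow> qbin q n 0 = 1"
  by (simp add: qbin_def qfac_rfac)

lemma qbin_sym: "qbin q n (n - k) = qbin q n k"
  by (simp add: qbin_def)

text \<open>Over a common denominator this is 1 - q^(n+1) = (1 - q^(n+1-k)) + q^(n+1-k) (1 -
  q^k).\<close>

lemma qbin_pascal:
  assumes q: "1 < q" and n: "0 \<le> n"
  shows "qbin q (n + 1) k = qbin q n k + q powi (n + 1 - k) * qbin q n (k - 1)"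
proof -
  have 1: "rfac q (n - k) = (1 - q powi (n + 1 - k)) * rfac q (n + 1 - k)"
    using rfac_pred[OF q, of "n + 1 - k"] by (simp add: algebra_simps)
  have 2: "q powi (n + 1) = q powi (n + 1 - k) * q powi k"
    using q by (simp flip: power_int_add)
  show ?thesis
    unfolding qbin_def qfac_add1[OF n] rfac_pred[OF q, of k] 1 2
    by (simp add: algebra_simps)
qed

lemma qbin_pascal':
  assumes q: "1 < q" and n: "0 \<le> n"
  shows "qbin q (n + 1) k = q powi k * qbin q n k + qbin q n (k - 1)"
proof -
  have "qbin q n (n + 1 - k) = qbin q n (k - 1)"
    using qbin_sym[of q n "k - 1"] by (simp add: algebra_simps)
  moreover have "qbin q n (n - k) = qbin q n k"
    by (rule qbin_sym)
  moreover have "qbin q (n + 1) (n + 1 - k) = qbin q (n + 1) k"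
    by (rule qbin_sym)
  ultimately show ?thesis
    using qbin_pascal[OF q n, of "n + 1 - k"] by (simp add: algebra_simps)
qed

text \<open>Induction on A: \<open>qbin_pascal\<close> applied to [A+1, k] splits the sum into the
  instances C and C - 1 for A, and the same rule for [A+B+1, C] reassembles them.\<close>

lemma qbin_vandermonde:
  assumes q: "1 < q" and B: "0 \<le> B"
  shows "qbin q (int A + B) C =
    (\<Sum>k\<in>{0..int A}. q powi (k * (B - C + k)) * qbin q (int A) k * qbin q B (C - k))"
proof (induction A arbitrary: C)
  case 0
  show ?case using q by simp
next
  case (Suc A)
  let ?f = "\<lambda>C k. q powi (k * (B - C + k)) * qbin q (int A) k * qbin q B (C - k)"
  have "(\<Sum>k\<in>{0..int (Suc A)}. q powi (k * (B - C + k)) * qbin q (int (Suc A)) k * qbin q B (C - k))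
      = (\<Sum>k\<in>{0..int A + 1}. ?f C k + q powi (int A + B - C + 1) * ?f (C - 1) (k - 1))"
  proof (rule sum.cong)
    fix k :: int
    have "q powi (k * (B - C + k)) * q powi (int A + 1 - k)
        = q powi (int A + B - C + 1) * q powi ((k - 1) * (B - (C - 1) + (k - 1)))"
      using q by (simp flip: power_int_add) (simp add: algebra_simps)
    then show "q powi (k * (B - C + k)) * qbin q (int (Suc A)) k * qbin q B (C - k)
      = ?f C k + q powi (int A + B - C + 1) * ?f (C - 1) (k - 1)"
      using qbin_pascal[OF q, of "int A" k] by (simp add: algebra_simps)
  qed simp
  also have "\<dots> = (\<Sum>k\<in>{0..int A + 1}. ?f C k)
      + q powi (int A + B - C + 1) * (\<Sum>k\<in>{0..int A + 1}. ?f (C - 1) (k - 1))"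
    by (simp add: sum.distrib sum_distrib_left)
  also have "(\<Sum>k\<in>{0..int A + 1}. ?f C k) = (\<Sum>k\<in>{0..int A}. ?f C k)"
    by (rule sum.mono_neutral_right) auto
  also have "(\<Sum>k\<in>{0..int A + 1}. ?f (C - 1) (k - 1)) = (\<Sum>k\<in>{-1..int A}. ?f (C - 1) k)"
    by (rule sum.reindex_bij_witness[of _ "\<lambda>k. k + 1" "\<lambda>k. k - 1"]) auto
  also have "\<dots> = (\<Sum>k\<in>{0..int A}. ?f (C - 1) k)"
    by (rule sum.mono_neutral_right) auto
  finally show ?case
    using qbin_pascal[OF q, of "int A + B" C] B Suc.IH[of C] Suc.IH[of "C - 1"]
    by (simp add: algebra_simps)
qed

text \<open>The exponent \<open>tri (i - 1)\<close> is the usual i(i-1)/2. By the Pascal rule and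
  the shift i -> i - 1, passing from n to n + 1 multiplies the sum by 1 - z q^n.\<close>

lemma qbin_theorem:
  assumes q: "1 < q" and z: "z \<noteq> 0"
  shows "(\<Sum>i\<in>{0..int n}. (-1) powi i * q powi tri (i - 1) * z powi i * qbin q (int n) i)
    = (\<Prod>k<n. 1 - z * q ^ k)"
proof (induction n)
  case 0
  show ?case using q by (simp add: tri_def)
next
  case (Suc n)
  let ?f = "\<lambda>i. (-1) powi i * q powi tri (i - 1) * z powi i * qbin q (int n) i"
  have "(\<Sum>i\<in>{0..int (Suc n)}. (-1) powi i * q powi tri (i - 1) * z powi i * qbin q (int (Suc n)) i)
      = (\<Sum>i\<in>{0..int n + 1}. ?f i - z * q ^ n * ?f (i - 1))"
  proof (rule sum.cong)
    fix i :: int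
    have "tri (i - 1) + (int n + 1 - i) = int n + tri (i - 1 - 1)"
      using tri2[of "i - 1"] tri2[of "i - 1 - 1"] by (simp add: algebra_simps)
    then have 1: "q powi tri (i - 1) * q powi (int n + 1 - i) = q ^ n * q powi tri (i - 1 - 1)"
      using q by (metis power_int_add power_int_of_nat not_one_less_zero)
    have 2: "(-1) powi i * z powi i = - z * ((-1) powi (i - 1) * z powi (i - 1))"
      using z by (simp add: power_int_diff)
    have "(-1) powi i * q powi tri (i - 1) * z powi i * qbin q (int (Suc n)) i
        = ?f i + ((-1) powi i * z powi i) * (q powi tri (i - 1) * q powi (int n + 1 - i)) * qbin q (int n) (i - 1)"
      using qbin_pascal[OF q, of "int n" i] by (simp add: algebra_simps)
    also have "\<dots> = ?f i - z * q ^ n * ?f (i - 1)"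
      unfolding 1 unfolding 2 by (simp add: mult_ac)
    finally show "(-1) powi i * q powi tri (i - 1) * z powi i * qbin q (int (Suc n)) i
      = ?f i - z * q ^ n * ?f (i - 1)" .
  qed simp
  also have "\<dots> = (\<Sum>i\<in>{0..int n + 1}. ?f i) - z * q ^ n * (\<Sum>i\<in>{0..int n + 1}. ?f (i - 1))"
    by (simp add: sum_subtractf sum_distrib_left)
  also have "(\<Sum>i\<in>{0..int n + 1}. ?f i) = (\<Sum>i\<in>{0..int n}. ?f i)"
    by (rule sum.mono_neutral_right) auto
  also have "(\<Sum>i\<in>{0..int n + 1}. ?f (i - 1)) = (\<Sum>i\<in>{-1..int n}. ?f i)"
    by (rule sum.reindex_bij_witness[of _ "\<lambda>k. k + 1" "\<lambda>k. k - 1"]) auto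
  also have "\<dots> = (\<Sum>i\<in>{0..int n}. ?f i)"
    by (rule sum.mono_neutral_right) auto
  finally show ?case
    unfolding Suc.IH by (simp add: algebra_simps)
qed

text \<open>Substituting j = r - i gives the q-binomial theorem at z = q^(e-r), whose product
  contains the factor 1 - z q^(r-e) = 0. The range contains the whole support for every r up to N
  and is invariant under j -> -1 - j, which \<open>rr_odd'\<close> exploits.\<close>

lemma qbin_orthogonality:
  assumes q: "1 < q" and r: "0 < r" "r \<le> N" and e: "e \<in> {0, 1}"
  shows "(\<Sum>j\<in>{-N-1..N}. (-1) powi j * q powi tri (j - e) * qbin q (2 * r + e) (r - j)) = 0"
proof -
  define n where "n = nat (2 * r + e)"
  have n: "int n = 2 * r + e" using r e by (auto simp: n_def)
  have "(\<Sum>j\<in>{-N-1..N}. (-1) powi j * q powi tri (j - e) * qbin q (2 * r + e) (r - j))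
    = (\<Sum>j\<in>{-r-e..r}. (-1) powi j * q powi tri (j - e) * qbin q (2 * r + e) (r - j))"
    by (rule sum.mono_neutral_right) (use r e in auto)
  also have "\<dots> = (\<Sum>i\<in>{0..int n}. (-1) powi (r - i) * q powi tri (r - i - e) * qbin q (2 * r + e) i)"
    by (rule sum.reindex_bij_witness[of _ "\<lambda>k. r - k" "\<lambda>k. r - k"]) (auto simp: n)
  also have "\<dots> = (\<Sum>i\<in>{0..int n}. (-1) powi r * q powi tri (r - e) *
      ((-1) powi i * q powi tri (i - 1) * (q powi (e - r)) powi i * qbin q (int n) i))"
  proof (rule sum.cong)
    fix i :: int
    have "tri (r - i - e) = tri (r - e) + tri (i - 1) + (e - r) * i"
      using tri2[of "r - i - e"] tri2[of "i - 1"] tri2[of "r - e"] by (simp add: algebra_simps)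
    then have "q powi tri (r - i - e) = q powi tri (r - e) * q powi tri (i - 1) * (q powi (e - r)) powi i"
      using q by (simp add: power_int_add power_int_mult)
    moreover have "(-1::real) powi (r - i) = (-1) powi r * (-1) powi i"
      by (simp add: power_int_minus_left flip: power_int_add)
    ultimately show "(-1) powi (r - i) * q powi tri (r - i - e) * qbin q (2 * r + e) i
      = (-1) powi r * q powi tri (r - e) *
      ((-1) powi i * q powi tri (i - 1) * (q powi (e - r)) powi i * qbin q (int n) i)"
      by (simp add: n mult_ac)
  qed simp
  also have "\<dots> = (-1) powi r * q powi tri (r - e) * (\<Prod>k<n. 1 - q powi (e - r) * q ^ k)"
    using qbin_theorem[OF q, of "q powi (e - r)" n] q by (simp flip: sum_distrib_left)
  also have "(\<Prod>k<n. 1 - q powi (e - r) * q ^ k) = 0"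
  proof -
    have "q powi (e - r) * q powi (int (nat (r - e))) = 1"
      using q r e by (subst power_int_add[symmetric]) auto
    then have "1 - q powi (e - r) * q ^ nat (r - e) = 0"
      by (simp only: power_int_of_nat)
    moreover have "nat (r - e) < n" using r e by (auto simp: n_def)
    ultimately show ?thesis by (metis finite_lessThan lessThan_iff prod_zero)
  qed
  finally show ?thesis by simp
qed

section \<open>The positivity preserving transformation\<close>

text \<open>Only powers of q and Gaussian binomials occur, so the kernel preserves positivity. The
  indices n and r are the shifted summation indices of the first and the second Vandermonde
  sum.\<close>

definition T :: "real \<Rightarrow> int \<Rightarrow> int \<Rightarrow> int \<Rightarrow> real" where
  "T q e L r = (\<Sum>n\<in>{0..L}. q powi (n * (n + e) + r * (r + e)) * qbin q L (2 * r + e) * qbin q (L - 2 * r - e) (n - r))"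

text \<open>Second Vandermonde sum: the left side is a multiple of [A+B, C] for the A, B, C below,
  and k = r - j is the Vandermonde index.\<close>

lemma qbin_product:
  assumes q: "1 < q" and e: "e \<in> {0, 1}"
  shows "q powi (j * (j + e)) * qbin q L (n - j) * qbin q L (n + j + e) =
    (\<Sum>r\<in>{0..L}. q powi (r * (r + e)) * qbin q L (2 * r + e) * qbin q (L - 2 * r - e) (n - r)
      * qbin q (2 * r + e) (r - j))"
proof -
  define A where "A = n - j"
  define B where "B = L - n + j"
  define C where "C = L - e - n - j"
  \<comment> \<open>The summand with the factorials of 2r + e and L - 2r - e cancelled; in this form
    its vanishing is read off from a single negative \<open>rfac\<close> argument.\<close>
  define f where "f r = q powi (r * (r + e)) * qfac q (nat L) * rfac q (n - r) * rfac q (L - n - r - e)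
    * rfac q (r - j) * rfac q (r + j + e)" for r
  have f: "f r = q powi (r * (r + e)) * qbin q L (2 * r + e) * qbin q (L - 2 * r - e) (n - r)
      * qbin q (2 * r + e) (r - j)" for r
  proof (cases "0 \<le> 2 * r + e \<and> 0 \<le> L - 2 * r - e")
    case True
    then have "qfac q (nat (2 * r + e)) * rfac q (2 * r + e) = 1"
      "qfac q (nat (L - 2 * r - e)) * rfac q (L - 2 * r - e) = 1"
      by (auto intro: qfac_rfac[OF q])
    moreover have "L - (2 * r + e) = L - 2 * r - e" "L - 2 * r - e - (n - r) = L - n - r - e"
      "2 * r + e - (r - j) = r + j + e" by auto
    ultimately show ?thesis
      unfolding f_def qbin_def by (simp add: algebra_simps)
  next
    case False
    \<comment> \<open>The arguments add up to 2r + e in the first product and to L - 2r - e in the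
      second; a negative sum forces a negative argument.\<close>
    then have "rfac q (r - j) * rfac q (r + j + e) = 0 \<or> rfac q (n - r) * rfac q (L - n - r - e) = 0"
      by (auto simp: rfac_def)
    then have "f r = 0" by (auto simp: f_def)
    then show ?thesis using False by auto
  qed
  show ?thesis
  proof (cases "0 \<le> A \<and> 0 \<le> B")
    case True
    have AB: "int (nat A) = A" "A + B = L" "A + B - C = n + j + e"
      using True by (auto simp: A_def B_def C_def)
    have L: "0 \<le> L" using AB True by linarith
    have V: "qbin q L C = (\<Sum>k\<in>{0..A}. q powi (k * (B - C + k)) * qbin q A k * qbin q B (C - k))"
      using qbin_vandermonde[OF q, of B "nat A" C] True AB by simp
    have ab: "qfac q (nat A) * rfac q A = 1" "qfac q (nat B) * rfac q B = 1"
      using True qfac_rfac[OF q] by auto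
    have "q powi (j * (j + e)) * qbin q L (n - j) * qbin q L (n + j + e)
      = q powi (j * (j + e)) * qfac q (nat L) * rfac q A * rfac q B * qbin q L C"
      by (simp add: qbin_def A_def B_def C_def algebra_simps)
    also have "\<dots> = (\<Sum>k\<in>{0..A}. f (k + j))"
      unfolding V sum_distrib_left
    proof (rule sum.cong)
      fix k
      have 1: "q powi (j * (j + e)) * q powi (k * (B - C + k)) = q powi ((k + j) * (k + j + e))"
        using q by (simp flip: power_int_add) (simp add: B_def C_def algebra_simps)
      have 2: "n - (k + j) = A - k" "L - n - (k + j) - e = C - k" "k + j - j = k" "k + j + j + e = B - (C - k)"
        by (simp_all add: A_def B_def C_def)
      have "q powi (j * (j + e)) * qfac q (nat L) * rfac q A * rfac q B *
          (q powi (k * (B - C + k)) * qbin q A k * qbin q B (C - k))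
        = (q powi (j * (j + e)) * q powi (k * (B - C + k))) * qfac q (nat L) * (qfac q (nat A) * rfac q A)
          * (qfac q (nat B) * rfac q B) * rfac q k * rfac q (A - k) * rfac q (C - k) * rfac q (B - (C - k))"
        unfolding qbin_def by (simp only: mult_ac)
      then show "q powi (j * (j + e)) * qfac q (nat L) * rfac q A * rfac q B *
          (q powi (k * (B - C + k)) * qbin q A k * qbin q B (C - k)) = f (k + j)"
        unfolding ab 1 f_def 2 by (simp only: mult_ac mult_1_left mult_1_right)
    qed simp
    also have "\<dots> = (\<Sum>r\<in>{j..n}. f r)"
      by (rule sum.reindex_bij_witness[of _ "\<lambda>r. r - j" "\<lambda>k. k + j"]) (auto simp: A_def)
    also have "\<dots> = (\<Sum>r\<in>{0..L}. f r)"
    proof (rule sum.mono_neutral_cong)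
      fix r assume "r \<in> {j..n} - {0..L}"
      \<comment> \<open>For r < 0 the sum 2r + e is negative, for r > L the sum L - 2r - e, so again
        some argument is negative.\<close>
      then have "r + j + e < 0 \<or> r - j < 0 \<or> L - n - r - e < 0 \<or> n - r < 0" using e by auto
      then show "f r = 0" by (auto simp: f_def)
    next
      fix r assume "r \<in> {0..L} - {j..n}"
      then show "f r = 0" by (auto simp: f_def)
    qed auto
    finally show ?thesis by (simp add: f)
  next
    case False
    have "f r = 0" for r
    proof -
      \<comment> \<open>Here n - r and r - j add up to A, the other two arguments to B.\<close>
      have "r - j < 0 \<or> n - r < 0 \<or> L - n - r - e < 0 \<or> r + j + e < 0"
        using False by (auto simp: A_def B_def)
      then show ?thesis by (auto simp: f_def)
    qed
    moreover have "qbin q L (n - j) = 0" using False by (auto simp: A_def B_def)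
    ultimately show ?thesis unfolding f[symmetric] by simp
  qed
qed

text \<open>First Vandermonde sum, for [L+L, L-e-2j]. With n = k + j its exponent plus 2j(j+e)
  equals n(n+e) + j(j+e), and the product [L, n-j] [L, n+j+e] is then expanded by
  \<open>qbin_product\<close>.\<close>

lemma qbin_transformation:
  assumes q: "1 < q" and e: "e \<in> {0, 1}" and L: "0 \<le> L"
  shows "q powi (2 * j * (j + e)) * qbin q (2 * L) (L - e - 2 * j)
    = (\<Sum>r\<in>{0..L}. T q e L r * qbin q (2 * r + e) (r - j))"
proof -
  let ?g = "\<lambda>n. q powi (n * (n + e)) * (q powi (j * (j + e)) * qbin q L (n - j) * qbin q L (n + j + e))"
  have "qbin q (2 * L) (L - e - 2 * j)
    = (\<Sum>k\<in>{0..L}. q powi (k * (k + e + 2 * j)) * qbin q L k * qbin q L (L - e - 2 * j - k))"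
    using qbin_vandermonde[OF q L, of "nat L" "L - e - 2 * j"] L by (simp add: algebra_simps)
  then have "q powi (2 * j * (j + e)) * qbin q (2 * L) (L - e - 2 * j)
    = (\<Sum>k\<in>{0..L}. q powi (2 * j * (j + e)) * (q powi (k * (k + e + 2 * j)) * qbin q L k * qbin q L (L - e - 2 * j - k)))"
    by (simp add: sum_distrib_left)
  also have "\<dots> = (\<Sum>k\<in>{0..L}. ?g (k + j))"
  proof (rule sum.cong)
    fix k
    have "q powi (2 * j * (j + e)) * q powi (k * (k + e + 2 * j))
      = q powi ((k + j) * (k + j + e)) * q powi (j * (j + e))"
      using q by (simp flip: power_int_add) (simp add: algebra_simps)
    moreover have "qbin q L (L - e - 2 * j - k) = qbin q L (k + j + j + e)"
      using qbin_sym[of q L "k + j + j + e"] by (simp add: algebra_simps)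
    ultimately show "q powi (2 * j * (j + e)) * (q powi (k * (k + e + 2 * j)) * qbin q L k * qbin q L (L - e - 2 * j - k))
      = ?g (k + j)" by (simp add: mult_ac)
  qed simp
  also have "\<dots> = (\<Sum>n\<in>{j..L + j}. ?g n)"
    by (rule sum.reindex_bij_witness[of _ "\<lambda>r. r - j" "\<lambda>k. k + j"]) auto
  also have "\<dots> = (\<Sum>n\<in>{0..L}. ?g n)"
  proof (rule sum.mono_neutral_cong)
    fix n assume "n \<in> {j..L + j} - {0..L}"
    then have "n + j + e < 0 \<or> n - j < 0 \<or> L < n - j \<or> L < n + j + e" using e by auto
    then show "?g n = 0" by auto
  next
    fix n assume "n \<in> {0..L} - {j..L + j}"
    then show "?g n = 0" by auto
  qed auto
  also have "\<dots> = (\<Sum>n\<in>{0..L}. \<Sum>r\<in>{0..L}. q powi (n * (n + e) + r * (r + e)) * qbin q L (2 * r + e)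
      * qbin q (L - 2 * r - e) (n - r) * qbin q (2 * r + e) (r - j))"
    unfolding qbin_product[OF q e] sum_distrib_left using q by (simp add: power_int_add mult_ac)
  also have "\<dots> = (\<Sum>r\<in>{0..L}. T q e L r * qbin q (2 * r + e) (r - j))"
    by (subst sum.swap) (simp add: T_def sum_distrib_right)
  finally show ?thesis .
qed

text \<open>Used with \<open>g j = j\<close> to evaluate the Rogers-Ramanujan sums and with
  \<open>g j = 2 * j\<close> for the three final sums.\<close>

lemma sum_transformation:
  assumes q: "1 < q" and e: "e \<in> {0, 1}" and L: "0 \<le> L"
  shows "(\<Sum>j\<in>J. c j * (q powi (2 * g j * (g j + e)) * qbin q (2 * L) (L - e - 2 * g j)))
    = (\<Sum>r\<in>{0..L}. T q e L r * (\<Sum>j\<in>J. c j * qbin q (2 * r + e) (r - g j)))"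
  unfolding qbin_transformation[OF q e L] sum_distrib_left
  by (subst sum.swap) (simp add: mult_ac)

section \<open>Finite Rogers--Ramanujan sums\<close>

definition RR :: "real \<Rightarrow> int \<Rightarrow> int \<Rightarrow> real" where
  "RR q e r = (\<Sum>n\<in>{0..r}. q powi (n * (n + e)) * qbin q r n)"

text \<open>The transformation absorbs q^(2j^2); orthogonality then leaves only s = 0, and
  \<open>T q 0 r 0\<close> is the right side. Keeping N separate from r lets one index range serve
  all r up to N.\<close>

lemma rr_even:
  assumes q: "1 < q" and r: "0 \<le> r" "r \<le> N"
  shows "(\<Sum>j\<in>{-N-1..N}. (-1) powi j * q powi (tri j + 2 * j\<^sup>2) * qbin q (2 * r) (r - 2 * j)) = RR q 0 r"
proof -
  have "(\<Sum>j\<in>{-N-1..N}. (-1) powi j * q powi (tri j + 2 * j\<^sup>2) * qbin q (2 * r) (r - 2 * j))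
    = (\<Sum>j\<in>{-N-1..N}. ((-1) powi j * q powi tri j) * (q powi (2 * j * (j + 0)) * qbin q (2 * r) (r - 0 - 2 * j)))"
    using q by (simp add: power_int_add power2_eq_square mult_ac)
  also have "\<dots> = (\<Sum>s\<in>{0..r}. T q 0 r s * (\<Sum>j\<in>{-N-1..N}. (-1) powi j * q powi tri j * qbin q (2 * s + 0) (s - j)))"
    using r by (intro sum_transformation[OF q]) auto
  also have "\<dots> = (\<Sum>s\<in>{0}. T q 0 r s * (\<Sum>j\<in>{-N-1..N}. (-1) powi j * q powi tri j * qbin q (2 * s + 0) (s - j)))"
    using r qbin_orthogonality[OF q, of _ N 0] by (intro sum.mono_neutral_right) auto
  also have "\<dots> = T q 0 r 0 * (\<Sum>j\<in>{-N-1..N}. (-1) powi j * q powi tri j * qbin q 0 (- j))"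
    by simp
  also have "(\<Sum>j\<in>{-N-1..N}. (-1) powi j * q powi tri j * qbin q 0 (- j)) =
      (\<Sum>j\<in>{0}. (-1) powi j * q powi tri j * qbin q 0 (- j))"
    using r by (intro sum.mono_neutral_right) auto
  finally show ?thesis
    using q r by (simp add: tri_def T_def RR_def)
qed

text \<open>The case e = 1 of the same argument, since tri(j) + 2j^2 + j = tri(j-1) + 2j(j+1). It
  supplies the second half of \<open>rr_odd\<close>.\<close>

lemma rr_odd_aux:
  assumes q: "1 < q" and r: "0 \<le> r" "r \<le> N"
  shows "(\<Sum>j\<in>{-N-1..N}. (-1) powi j * q powi (tri j + 2 * j\<^sup>2 + j) * qbin q (2 * r) (r - 1 - 2 * j))
    = (1 - q powi r) * RR q 1 (r - 1)"
proof -
  have "(\<Sum>j\<in>{-N-1..N}. (-1) powi j * q powi (tri j + 2 * j\<^sup>2 + j) * qbin q (2 * r) (r - 1 - 2 * j))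
    = (\<Sum>j\<in>{-N-1..N}. ((-1) powi j * q powi tri (j - 1)) * (q powi (2 * j * (j + 1)) * qbin q (2 * r) (r - 1 - 2 * j)))"
  proof (rule sum.cong)
    fix j
    have "tri j + 2 * j\<^sup>2 + j = tri (j - 1) + 2 * j * (j + 1)"
      using tri2[of j] tri2[of "j - 1"] by (simp add: algebra_simps power2_eq_square)
    then show "(-1) powi j * q powi (tri j + 2 * j\<^sup>2 + j) * qbin q (2 * r) (r - 1 - 2 * j)
      = ((-1) powi j * q powi tri (j - 1)) * (q powi (2 * j * (j + 1)) * qbin q (2 * r) (r - 1 - 2 * j))"
      using q by (simp add: power_int_add)
  qed simp
  also have "\<dots> = (\<Sum>s\<in>{0..r}. T q 1 r s * (\<Sum>j\<in>{-N-1..N}. (-1) powi j * q powi tri (j - 1) * qbin q (2 * s + 1) (s - j)))"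
    using r by (intro sum_transformation[OF q]) auto
  also have "\<dots> = (\<Sum>s\<in>{0}. T q 1 r s * (\<Sum>j\<in>{-N-1..N}. (-1) powi j * q powi tri (j - 1) * qbin q (2 * s + 1) (s - j)))"
    using r qbin_orthogonality[OF q, of _ N 1] by (intro sum.mono_neutral_right) auto
  also have "\<dots> = T q 1 r 0 * (\<Sum>j\<in>{-N-1..N}. (-1) powi j * q powi tri (j - 1) * qbin q 1 (- j))"
    by simp
  also have "(\<Sum>j\<in>{-N-1..N}. (-1) powi j * q powi tri (j - 1) * qbin q 1 (- j)) =
      (\<Sum>j\<in>{-1, 0}. (-1) powi j * q powi tri (j - 1) * qbin q 1 (- j))"
  proof (rule sum.mono_neutral_right)
    have "qbin q 1 (- j) = 0" if "j \<notin> {-1, 0}" for j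
      using that by (cases "0 < j") auto
    then show "\<forall>j\<in>{-N-1..N} - {-1, 0}. (-1) powi j * q powi tri (j - 1) * qbin q 1 (- j) = 0"
      by simp
  qed (use r in auto)
  \<comment> \<open>The terms j = 0 and j = -1 contribute 1 and -q, as
    \<open>tri (- 2) = 1\<close>.\<close>
  also have "\<dots> = 1 - q"
    using q qbin_sym[of q 1 0] by (simp add: tri_def)
  also have "T q 1 r 0 = qbin q r 1 * RR q 1 (r - 1)"
  proof -
    have "T q 1 r 0 = qbin q r 1 * (\<Sum>n\<in>{0..r}. q powi (n * (n + 1)) * qbin q (r - 1) n)"
      by (simp add: T_def sum_distrib_left mult_ac)
    also have "(\<Sum>n\<in>{0..r}. q powi (n * (n + 1)) * qbin q (r - 1) n) = RR q 1 (r - 1)"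
      unfolding RR_def by (rule sum.mono_neutral_right) auto
    finally show ?thesis .
  qed
  also have "qbin q r 1 * RR q 1 (r - 1) * (1 - q) = ((1 - q) * qbin q r 1) * RR q 1 (r - 1)"
    by (simp only: mult_ac)
  also have "(1 - q) * qbin q r 1 = 1 - q powi r"
  proof (cases "r = 0")
    case False
    have "rfac q (r - 1) = (1 - q powi r) * rfac q r" "rfac q 0 = (1 - q powi 1) * rfac q 1"
      using rfac_pred[OF q, of r] rfac_pred[OF q, of 1] by auto
    then have 1: "rfac q (r - 1) = (1 - q powi r) * rfac q r" and 2: "(1 - q) * rfac q 1 = 1"
      by simp_all
    have "(1 - q) * qbin q r 1 = (qfac q (nat r) * rfac q r) * ((1 - q) * rfac q 1) * (1 - q powi r)"
      unfolding qbin_def 1 by (simp only: mult_ac)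
    then show ?thesis unfolding qfac_rfac[OF q r(1)] 2 by simp
  qed (use q in auto)
  finally show ?thesis .
qed

text \<open>For r > 0 the two Pascal rules write \<open>RR q 0 r\<close> and \<open>RR q 1 r\<close>
  as \<open>RR q 1 (r - 1)\<close> plus X and plus q^r X, with the same X; eliminating X gives the
  claim.\<close>

lemma RR_recurrence:
  assumes q: "1 < q" and r: "0 \<le> r"
  shows "RR q 1 r = q powi r * RR q 0 r + (1 - q powi r) * RR q 1 (r - 1)"
proof (cases "r = 0")
  case True
  then show ?thesis using q by (simp add: RR_def)
next
  case False
  let ?X = "\<Sum>n\<in>{0..r}. q powi (n * n) * qbin q (r - 1) (n - 1)"
  have E: "RR q 1 (r - 1) = (\<Sum>n\<in>{0..r}. q powi (n * (n + 1)) * qbin q (r - 1) n)"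
    unfolding RR_def by (rule sum.mono_neutral_left) auto
  have "RR q 0 r = RR q 1 (r - 1) + ?X"
    unfolding E unfolding RR_def sum.distrib[symmetric]
  proof (rule sum.cong)
    fix n
    have "q powi (n * n) * q powi n = q powi (n * (n + 1))"
      using q by (simp flip: power_int_add) (simp add: algebra_simps)
    then show "q powi (n * (n + 0)) * qbin q r n
      = q powi (n * (n + 1)) * qbin q (r - 1) n + q powi (n * n) * qbin q (r - 1) (n - 1)"
      using qbin_pascal'[OF q, of "r - 1" n] False r by (simp add: algebra_simps)
  qed simp
  moreover have "RR q 1 r = RR q 1 (r - 1) + q powi r * ?X"
    unfolding E unfolding RR_def sum_distrib_left sum.distrib[symmetric]
  proof (rule sum.cong)
    fix n
    have "q powi (n * (n + 1)) * q powi (r - n) = q powi r * q powi (n * n)"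
      using q by (simp flip: power_int_add) (simp add: algebra_simps)
    then show "q powi (n * (n + 1)) * qbin q r n
      = q powi (n * (n + 1)) * qbin q (r - 1) n + q powi r * (q powi (n * n) * qbin q (r - 1) (n - 1))"
      using qbin_pascal[OF q, of "r - 1" n] False r by (simp add: algebra_simps)
  qed simp
  ultimately show ?thesis by (simp add: algebra_simps)
qed

text \<open>The second Pascal rule splits the sum. After j -> -j one part is q^r times the sum of
  \<open>rr_even\<close>, the other is that of \<open>rr_odd_aux\<close>, and
  \<open>RR_recurrence\<close> combines them.\<close>

lemma rr_odd:
  assumes q: "1 < q" and r: "0 \<le> r" "r \<le> N"
  shows "(\<Sum>j\<in>{-N-1..N}. (-1) powi j * q powi (tri j + 2 * j\<^sup>2 + j) * qbin q (2 * r + 1) (r - 2 * j)) = RR q 1 r"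
proof -
  have "(\<Sum>j\<in>{-N-1..N}. (-1) powi j * q powi (tri j + 2 * j\<^sup>2 + j) * qbin q (2 * r + 1) (r - 2 * j))
    = (\<Sum>j\<in>{-N-1..N}. q powi r * ((-1) powi (- j) * q powi (tri (- j) + 2 * (- j)\<^sup>2) * qbin q (2 * r) (r - 2 * (- j)))
      + (-1) powi j * q powi (tri j + 2 * j\<^sup>2 + j) * qbin q (2 * r) (r - 1 - 2 * j))"
  proof (rule sum.cong)
    fix j
    have "(tri j + 2 * j\<^sup>2 + j) + (r - 2 * j) = r + (tri (- j) + 2 * (- j)\<^sup>2)"
      using tri2[of j] tri2[of "- j"] by (simp add: algebra_simps power2_eq_square)
    then have "q powi (tri j + 2 * j\<^sup>2 + j) * q powi (r - 2 * j) = q powi r * q powi (tri (- j) + 2 * (- j)\<^sup>2)"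
      using q by (metis power_int_add not_one_less_zero)
    moreover have "(-1::real) powi (- j) = (-1) powi j"
      by (simp add: power_int_minus_left)
    moreover have "qbin q (2 * r) (r - 2 * (- j)) = qbin q (2 * r) (r - 2 * j)"
      using qbin_sym[of q "2 * r" "r - 2 * j"] by (simp add: algebra_simps)
    moreover have "qbin q (2 * r + 1) (r - 2 * j) = q powi (r - 2 * j) * qbin q (2 * r) (r - 2 * j)
        + qbin q (2 * r) (r - 1 - 2 * j)"
      using qbin_pascal'[OF q, of "2 * r" "r - 2 * j"] r by (simp add: algebra_simps)
    ultimately show "(-1) powi j * q powi (tri j + 2 * j\<^sup>2 + j) * qbin q (2 * r + 1) (r - 2 * j)
      = q powi r * ((-1) powi (- j) * q powi (tri (- j) + 2 * (- j)\<^sup>2) * qbin q (2 * r) (r - 2 * (- j)))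
      + (-1) powi j * q powi (tri j + 2 * j\<^sup>2 + j) * qbin q (2 * r) (r - 1 - 2 * j)"
      by (simp add: distrib_left)
  qed simp
  also have "\<dots> = q powi r * (\<Sum>j\<in>{-N-1..N}. (-1) powi (- j) * q powi (tri (- j) + 2 * (- j)\<^sup>2) * qbin q (2 * r) (r - 2 * (- j)))
      + (1 - q powi r) * RR q 1 (r - 1)"
    unfolding sum.distrib rr_odd_aux[OF q r] by (simp add: sum_distrib_left)
  also have "(\<Sum>j\<in>{-N-1..N}. (-1) powi (- j) * q powi (tri (- j) + 2 * (- j)\<^sup>2) * qbin q (2 * r) (r - 2 * (- j)))
    = (\<Sum>j\<in>{-N..N+1}. (-1) powi j * q powi (tri j + 2 * j\<^sup>2) * qbin q (2 * r) (r - 2 * j))"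
    by (rule sum.reindex_bij_witness[of _ "\<lambda>k. - k" "\<lambda>k. - k"]) auto
  \<comment> \<open>The ranges differ only in j = N + 1 and j = -N - 1, where the binomial vanishes
    because r is at most N.\<close>
  also have "\<dots> = (\<Sum>j\<in>{-N-1..N}. (-1) powi j * q powi (tri j + 2 * j\<^sup>2) * qbin q (2 * r) (r - 2 * j))"
    using r by (intro sum.mono_neutral_cong) auto
  finally show ?thesis
    unfolding rr_even[OF q r] using RR_recurrence[OF q r(1)] by simp
qed

text \<open>By the first Pascal rule the sum is that of \<open>rr_even\<close> plus a sum of terms
  \<open>h j\<close>. These are antisymmetric under j -> -1 - j, a bijection of the range, and
  cancel.\<close>

lemma rr_odd':
  assumes q: "1 < q" and r: "0 \<le> r" "r \<le> N"
  shows "(\<Sum>j\<in>{-N-1..N}. (-1) powi j * q powi (tri j + 2 * j\<^sup>2) * qbin q (2 * r + 1) (r - 2 * j)) = RR q 0 r"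
proof -
  define h where "h j = (-1) powi j * q powi (tri j + 2 * j\<^sup>2 + r + 1 + 2 * j) * qbin q (2 * r) (r - 1 - 2 * j)" for j
  have h: "h (- 1 - j) = - h j" for j
  proof -
    have 1: "tri (- 1 - j) + 2 * (- 1 - j)\<^sup>2 + r + 1 + 2 * (- 1 - j) = tri j + 2 * j\<^sup>2 + r + 1 + 2 * j"
      using tri2[of j] tri2[of "- 1 - j"] by (simp add: algebra_simps power2_eq_square)
    have 2: "(-1::real) powi (- 1 - j) = - ((-1) powi j)"
      by (simp add: power_int_minus_left)
    have 3: "qbin q (2 * r) (r - 1 - 2 * (- 1 - j)) = qbin q (2 * r) (r - 1 - 2 * j)"
      using qbin_sym[of q "2 * r" "r - 1 - 2 * j"] by (simp add: algebra_simps)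
    show ?thesis unfolding h_def 1 2 3 by simp
  qed
  have "(\<Sum>j\<in>{-N-1..N}. h j) = (\<Sum>j\<in>{-N-1..N}. h (- 1 - j))"
    by (rule sum.reindex_bij_witness[of _ "\<lambda>k. - 1 - k" "\<lambda>k. - 1 - k"]) auto
  then have h0: "(\<Sum>j\<in>{-N-1..N}. h j) = 0"
    unfolding h by (simp add: sum_negf)
  have "(\<Sum>j\<in>{-N-1..N}. (-1) powi j * q powi (tri j + 2 * j\<^sup>2) * qbin q (2 * r + 1) (r - 2 * j))
    = (\<Sum>j\<in>{-N-1..N}. (-1) powi j * q powi (tri j + 2 * j\<^sup>2) * qbin q (2 * r) (r - 2 * j) + h j)"
  proof (rule sum.cong)
    fix j
    have "q powi (tri j + 2 * j\<^sup>2 + r + 1 + 2 * j) = q powi (tri j + 2 * j\<^sup>2) * q powi (r + 1 + 2 * j)"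
      using q by (simp flip: power_int_add) (simp add: algebra_simps)
    moreover have "qbin q (2 * r + 1) (r - 2 * j) = qbin q (2 * r) (r - 2 * j)
        + q powi (r + 1 + 2 * j) * qbin q (2 * r) (r - 1 - 2 * j)"
      using qbin_pascal[OF q, of "2 * r" "r - 2 * j"] r by (simp add: algebra_simps)
    ultimately show "(-1) powi j * q powi (tri j + 2 * j\<^sup>2) * qbin q (2 * r + 1) (r - 2 * j)
      = (-1) powi j * q powi (tri j + 2 * j\<^sup>2) * qbin q (2 * r) (r - 2 * j) + h j"
      unfolding h_def by (simp add: distrib_left mult_ac)
  qed simp
  then show ?thesis
    unfolding sum.distrib rr_even[OF q r] h0 by simp
qed

section \<open>The three alternating sums\<close>

lemma alternating_sum_even:
  assumes q: "1 < q" and L: "0 \<le> L"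
  shows "(\<Sum>j\<in>{-L-1..L}. (-1) powi j * q powi (tri j + 10 * j\<^sup>2) * qbin q (2 * L) (L - 4 * j))
    = (\<Sum>r\<in>{0..L}. T q 0 L r * RR q 0 r)"
proof -
  have "(\<Sum>j\<in>{-L-1..L}. (-1) powi j * q powi (tri j + 10 * j\<^sup>2) * qbin q (2 * L) (L - 4 * j))
    = (\<Sum>j\<in>{-L-1..L}. ((-1) powi j * q powi (tri j + 2 * j\<^sup>2))
      * (q powi (2 * (2 * j) * (2 * j + 0)) * qbin q (2 * L) (L - 0 - 2 * (2 * j))))"
  proof (rule sum.cong)
    fix j
    have "q powi (tri j + 10 * j\<^sup>2) = q powi (tri j + 2 * j\<^sup>2) * q powi (2 * (2 * j) * (2 * j + 0))"
      using q by (simp flip: power_int_add) (simp add: algebra_simps power2_eq_square)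
    then show "(-1) powi j * q powi (tri j + 10 * j\<^sup>2) * qbin q (2 * L) (L - 4 * j)
      = ((-1) powi j * q powi (tri j + 2 * j\<^sup>2))
      * (q powi (2 * (2 * j) * (2 * j + 0)) * qbin q (2 * L) (L - 0 - 2 * (2 * j)))"
      by simp
  qed simp
  also have "\<dots> = (\<Sum>r\<in>{0..L}. T q 0 L r * (\<Sum>j\<in>{-L-1..L}. (-1) powi j * q powi (tri j + 2 * j\<^sup>2) * qbin q (2 * r + 0) (r - 2 * j)))"
    by (rule sum_transformation[OF q _ L]) simp
  also have "\<dots> = (\<Sum>r\<in>{0..L}. T q 0 L r * RR q 0 r)"
    using rr_even[OF q] by (intro sum.cong) auto
  finally show ?thesis .
qed

text \<open>The exponent splits as 10j^2 + (4+d)j = (2j^2 + dj) + 2(2j)(2j+1); after the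
  transformation d = 1 calls for \<open>rr_odd\<close> and d = 0 for \<open>rr_odd'\<close>.\<close>

lemma alternating_sum_odd:
  assumes q: "1 < q" and L: "0 \<le> L" and d: "d \<in> {0, 1}"
  shows "(\<Sum>j\<in>{-L-1..L}. (-1) powi j * q powi (tri j + 10 * j\<^sup>2 + (4 + d) * j) * qbin q (2 * L) (L - 1 - 4 * j))
    = (\<Sum>r\<in>{0..L}. T q 1 L r * RR q d r)"
proof -
  have "(\<Sum>j\<in>{-L-1..L}. (-1) powi j * q powi (tri j + 10 * j\<^sup>2 + (4 + d) * j) * qbin q (2 * L) (L - 1 - 4 * j))
    = (\<Sum>j\<in>{-L-1..L}. ((-1) powi j * q powi (tri j + 2 * j\<^sup>2 + d * j))
      * (q powi (2 * (2 * j) * (2 * j + 1)) * qbin q (2 * L) (L - 1 - 2 * (2 * j))))"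
  proof (rule sum.cong)
    fix j
    have "q powi (tri j + 10 * j\<^sup>2 + (4 + d) * j) = q powi (tri j + 2 * j\<^sup>2 + d * j) * q powi (2 * (2 * j) * (2 * j + 1))"
      using q by (simp flip: power_int_add) (simp add: algebra_simps power2_eq_square)
    then show "(-1) powi j * q powi (tri j + 10 * j\<^sup>2 + (4 + d) * j) * qbin q (2 * L) (L - 1 - 4 * j)
      = ((-1) powi j * q powi (tri j + 2 * j\<^sup>2 + d * j))
      * (q powi (2 * (2 * j) * (2 * j + 1)) * qbin q (2 * L) (L - 1 - 2 * (2 * j)))"
      by simp
  qed simp
  also have "\<dots> = (\<Sum>r\<in>{0..L}. T q 1 L r * (\<Sum>j\<in>{-L-1..L}. (-1) powi j * q powi (tri j + 2 * j\<^sup>2 + d * j) * qbin q (2 * r + 1) (r - 2 * j)))"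
    by (rule sum_transformation[OF q _ L]) simp
  also have "\<dots> = (\<Sum>r\<in>{0..L}. T q 1 L r * RR q d r)"
    using rr_odd[OF q] rr_odd'[OF q] d by (intro sum.cong) auto
  finally show ?thesis .
qed

section \<open>Lifting to integer polynomials\<close>

definition nonneg_coeffs :: "int poly \<Rightarrow> bool" where
  "nonneg_coeffs p \<longleftrightarrow> (\<forall>i. 0 \<le> coeff p i)"

lemma nonneg_coeffs_0: "nonneg_coeffs 0"
  by (simp add: nonneg_coeffs_def)

lemma nonneg_coeffs_monom: "nonneg_coeffs (monom 1 n)"
  by (simp add: nonneg_coeffs_def)

lemma nonneg_coeffs_1: "nonneg_coeffs 1"
  using nonneg_coeffs_monom[of 0] by simp

lemma nonneg_coeffs_add: "nonneg_coeffs p \<Longrightarrow> nonneg_coeffs p' \<Longrightarrow> nonneg_coeffs (p + p')"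
  by (simp add: nonneg_coeffs_def)

lemma nonneg_coeffs_mult: "nonneg_coeffs p \<Longrightarrow> nonneg_coeffs p' \<Longrightarrow> nonneg_coeffs (p * p')"
  by (auto simp: nonneg_coeffs_def coeff_mult intro!: sum_nonneg)

lemma nonneg_coeffs_sum: "(\<And>i. i \<in> A \<Longrightarrow> nonneg_coeffs (f i)) \<Longrightarrow> nonneg_coeffs (sum f A)"
  by (auto simp: nonneg_coeffs_def coeff_sum intro!: sum_nonneg)

section \<open>Integer Gaussian binomials: exact division, positivity, evaluation\<close>

lemma q_factorial_0: "q_factorial 0 = 1"
  by (simp add: q_factorial_def)

lemma q_factorial_Suc: "q_factorial (Suc n) = q_factorial n * (1 - monom 1 (Suc n))"
  by (simp add: q_factorial_def)

lemma q_factorial_nonzero: "q_factorial n \<noteq> 0"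
proof (induction n)
  case (Suc n)
  have "coeff (1 - monom 1 (Suc n) :: int poly) 0 = 1" by simp
  then have "(1 - monom 1 (Suc n) :: int poly) \<noteq> 0" by (metis coeff_0 zero_neq_one)
  then show ?case using Suc by (simp add: q_factorial_Suc)
qed (simp add: q_factorial_0)

text \<open>Divisibility and positivity come from one induction: if p1 and p2 are the quotients for
  (n, l) and (n, l+1), then p1 + q^(l+1) p2 is the quotient for (n+1, l+1).\<close>

lemma q_factorial_dvd:
  "k \<le> n \<Longrightarrow> \<exists>p. nonneg_coeffs p \<and> p * (q_factorial k * q_factorial (n - k)) = q_factorial n"
proof (induction n arbitrary: k)
  case 0
  then show ?case using nonneg_coeffs_1 by (auto simp: q_factorial_0)
next
  case (Suc n)
  show ?case
  proof (cases "k = 0 \<or> k = Suc n")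
    case True
    then show ?thesis using nonneg_coeffs_1 by (intro exI[of _ 1]) (auto simp: q_factorial_0)
  next
    case False
    then obtain l where l: "k = Suc l" "Suc l \<le> n" using Suc.prems by (cases k) auto
    obtain p1 where p1: "nonneg_coeffs p1" "p1 * (q_factorial l * q_factorial (n - l)) = q_factorial n"
      using Suc.IH[of l] l by auto
    obtain p2 where p2: "nonneg_coeffs p2"
      "p2 * (q_factorial (Suc l) * q_factorial (n - Suc l)) = q_factorial n"
      using Suc.IH[of "Suc l"] l by auto
    have nl: "q_factorial (n - l) = q_factorial (n - Suc l) * (1 - monom 1 (n - l))"
      using q_factorial_Suc[of "n - Suc l"] l by (simp add: Suc_diff_Suc)
    have "monom 1 (Suc l) * monom 1 (n - l) = (monom 1 (Suc n) :: int poly)"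
      using l by (simp add: mult_monom)
    then have m: "(1 - monom 1 (Suc l)) + monom 1 (Suc l) * (1 - monom 1 (n - l)) = (1 - monom 1 (Suc n) :: int poly)"
      by (simp add: right_diff_distrib)
    have "p1 * (q_factorial (Suc l) * q_factorial (n - l))
      = p1 * (q_factorial l * q_factorial (n - l)) * (1 - monom 1 (Suc l))"
      unfolding q_factorial_Suc by (simp only: mult_ac)
    moreover have "monom 1 (Suc l) * p2 * (q_factorial (Suc l) * q_factorial (n - l))
      = p2 * (q_factorial (Suc l) * q_factorial (n - Suc l)) * (monom 1 (Suc l) * (1 - monom 1 (n - l)))"
      unfolding nl by (simp only: mult_ac)
    ultimately have "(p1 + monom 1 (Suc l) * p2) * (q_factorial (Suc l) * q_factorial (n - l))
      = p1 * (q_factorial l * q_factorial (n - l)) * (1 - monom 1 (Suc l))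
        + p2 * (q_factorial (Suc l) * q_factorial (n - Suc l)) * (monom 1 (Suc l) * (1 - monom 1 (n - l)))"
      by (simp only: distrib_right)
    also have "\<dots> = q_factorial (Suc n)"
      unfolding p1(2) p2(2) q_factorial_Suc[of n] distrib_left[symmetric] m ..
    finally have "(p1 + monom 1 (Suc l) * p2) * (q_factorial k * q_factorial (Suc n - k)) = q_factorial (Suc n)"
      unfolding l(1) diff_Suc_Suc .
    moreover have "nonneg_coeffs (p1 + monom 1 (Suc l) * p2)"
      by (intro nonneg_coeffs_add nonneg_coeffs_mult nonneg_coeffs_monom p1 p2)
    ultimately show ?thesis by blast
  qed
qed

lemma q_binomial_spec:
  assumes "0 \<le> B" "B \<le> A"
  shows "nonneg_coeffs (q_binomial A B)"
    and "q_binomial A B * (q_factorial (nat B) * q_factorial (nat (A - B))) = q_factorial (nat A)"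
proof -
  obtain p where p: "nonneg_coeffs p"
    "p * (q_factorial (nat B) * q_factorial (nat A - nat B)) = q_factorial (nat A)"
    using q_factorial_dvd[of "nat B" "nat A"] nat_mono[OF assms(2)] by blast
  have "q_binomial A B = p"
    using assms q_factorial_nonzero
    by (simp add: q_binomial_def nat_diff_distrib p(2)[symmetric])
  then show "nonneg_coeffs (q_binomial A B)"
    and "q_binomial A B * (q_factorial (nat B) * q_factorial (nat (A - B))) = q_factorial (nat A)"
    using p assms by (simp_all add: nat_diff_distrib)
qed

lemma nonneg_coeffs_q_binomial: "nonneg_coeffs (q_binomial A B)"
  using q_binomial_spec(1)[of B A] nonneg_coeffs_0 by (auto simp: q_binomial_def)

lemma eval_q_factorial: "real_of_int (poly (q_factorial n) x) = qfac (real_of_int x) n"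
  by (simp add: q_factorial_def qfac_def poly_prod poly_monom)

lemma eval_q_binomial:
  assumes "1 < x"
  shows "real_of_int (poly (q_binomial A B) x) = qbin (real_of_int x) A B"
proof (cases "0 \<le> B \<and> B \<le> A")
  case True
  then have "real_of_int (poly (q_binomial A B * (q_factorial (nat B) * q_factorial (nat (A - B)))) x)
    = qfac (real_of_int x) (nat A)"
    using q_binomial_spec(2)[of B A] by (simp only: eval_q_factorial)
  then have "real_of_int (poly (q_binomial A B) x) * (qfac (real_of_int x) (nat B) * qfac (real_of_int x) (nat (A - B)))
    = qfac (real_of_int x) (nat A)"
    by (simp add: eval_q_factorial)
  moreover have "qfac (real_of_int x) m \<noteq> 0" for m
    using assms by (intro qfac_nonzero) simp
  ultimately show ?thesis
    using True by (simp add: qbin_def rfac_def field_simps)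
qed (auto simp: q_binomial_def)

text \<open>A nonzero difference would have only finitely many roots. This turns identities at real
  q > 1 into polynomial identities.\<close>

lemma poly_eqI_eval:
  fixes p p' :: "int poly"
  assumes "\<And>x. 1 < x \<Longrightarrow> real_of_int (poly p x) = real_of_int (poly p' x)"
  shows "p = p'"
proof (rule ccontr)
  assume "p \<noteq> p'"
  then have "finite {x. poly (p - p') x = 0}" by (intro poly_roots_finite) simp
  moreover have "{1<..} \<subseteq> {x. poly (p - p') x = 0}" using assms by auto
  ultimately show False using infinite_Ioi[of "1::int"] finite_subset by blast
qed

text \<open>Polynomial lift of \<open>T\<close>. For nonnegative e and r the exponents are
  nonnegative, so \<open>nat\<close> loses nothing.\<close>

definition T_poly :: "int \<Rightarrow> int \<Rightarrow> int \<Rightarrow> int poly" where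
  "T_poly e L r = (\<Sum>n\<in>{0..L}. monom 1 (nat (n * (n + e) + r * (r + e))) * q_binomial L (2 * r + e)
    * q_binomial (L - 2 * r - e) (n - r))"

definition RR_poly :: "int \<Rightarrow> int \<Rightarrow> int poly" where
  "RR_poly e r = (\<Sum>n\<in>{0..r}. monom 1 (nat (n * (n + e))) * q_binomial r n)"

lemma eval_monom_nat:
  "0 \<le> n \<Longrightarrow> real_of_int (poly (monom 1 (nat n)) x) = real_of_int x powi n"
  by (simp add: poly_monom power_int_def)

lemma eval_T_poly:
  assumes "1 < x" "0 \<le> e" "0 \<le> r"
  shows "real_of_int (poly (T_poly e L r) x) = T (real_of_int x) e L r"
  using assms by (simp add: T_poly_def T_def poly_sum eval_q_binomial eval_monom_nat)

lemma eval_RR_poly: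
  assumes "1 < x" "0 \<le> e"
  shows "real_of_int (poly (RR_poly e r) x) = RR (real_of_int x) e r"
  using assms by (simp add: RR_poly_def RR_def poly_sum eval_q_binomial eval_monom_nat)

lemma nonneg_coeffs_T_RR: "nonneg_coeffs (\<Sum>r\<in>{0..L}. T_poly e L r * RR_poly d r)"
  unfolding T_poly_def RR_poly_def
  by (intro nonneg_coeffs_sum nonneg_coeffs_mult nonneg_coeffs_monom nonneg_coeffs_q_binomial)

section \<open>Polynomials as formal series in rational powers\<close>

lemma q_poly_eq_sum:
  assumes "degree p \<le> N"
  shows "q_poly p = (\<Sum>i\<le>N. Poly_Mapping.single (of_nat i) (coeff p i))"
  unfolding q_poly_def using assms
  by (intro sum.mono_neutral_left) (auto simp: coeff_eq_0)

lemma q_poly_0 [simp]: "q_poly 0 = 0"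
  by (simp add: q_poly_def)

lemma q_poly_add: "q_poly (p + p') = q_poly p + q_poly p'"
proof -
  define N where "N = max (degree p) (degree p')"
  have "degree (p + p') \<le> N" "degree p \<le> N" "degree p' \<le> N"
    by (auto simp: N_def degree_add_le_max)
  then show ?thesis by (simp add: q_poly_eq_sum[of _ N] single_add sum.distrib)
qed

lemma q_poly_minus: "q_poly (- p) = - q_poly p"
  by (simp add: q_poly_def single_uminus sum_negf)

lemma q_poly_sum: "q_poly (sum f A) = (\<Sum>i\<in>A. q_poly (f i))"
  by (induction A rule: infinite_finite_induct) (simp_all add: q_poly_add)

lemma q_poly_pCons_0: "q_poly (pCons 0 p) = Poly_Mapping.single 1 1 * q_poly p"
proof -
  have "q_poly (pCons 0 p) = (\<Sum>i\<le>Suc (degree p). Poly_Mapping.single (of_nat i) (coeff (pCons 0 p) i))"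
    by (rule q_poly_eq_sum) (simp add: degree_pCons_le)
  also have "\<dots> = (\<Sum>i\<le>degree p. Poly_Mapping.single (of_nat (Suc i)) (coeff p i))"
    by (subst sum.atMost_Suc_shift) simp
  also have "\<dots> = Poly_Mapping.single 1 1 * q_poly p"
    by (simp add: q_poly_def sum_distrib_left mult_single)
  finally show ?thesis .
qed

text \<open>Every term of \<open>G\<close> is a sign times a power of q times a binomial, so
  compatibility of \<open>q_poly\<close> with monomials and signs suffices.\<close>

lemma q_poly_monom_mult: "q_poly (monom 1 n * p) = Poly_Mapping.single (of_nat n) 1 * q_poly p"
proof (induction n)
  case 0
  have "Poly_Mapping.single (0::rat) (1::int) = 1" by simp
  then show ?case by simp
next
  case (Suc n)
  have 1: "monom 1 (Suc n) * p = pCons 0 (monom 1 n * p)"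
    by (simp add: monom_Suc)
  have 2: "Poly_Mapping.single (of_nat (Suc n)) 1
      = (Poly_Mapping.single 1 1 * Poly_Mapping.single (of_nat n) 1 :: qseries)"
    by (simp add: mult_single)
  show ?case
    unfolding 1 2 q_poly_pCons_0 Suc by (simp only: mult.assoc)
qed

lemma q_poly_sign_mult: "q_poly ((-1) ^ n * p) = (-1) ^ n * q_poly p"
  by (cases "even n") (simp_all add: q_poly_minus)

lemma G_eq_q_poly:
  assumes L: "0 \<le> L" and NM: "N + M = 2 * L" and N: "N = L - e" "e \<in> {0, 1}"
    and t: "\<And>j. 0 \<le> t j"
      "\<And>j. of_int 4 * of_int j * (((\<alpha> + \<beta>) * of_int j + (\<alpha> - \<beta>)) / 2) = (of_int (t j) :: rat)"
  shows "G N M \<alpha> \<beta> 4 =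
    q_poly (\<Sum>j\<in>{-L-1..L}. (-1) ^ nat \<bar>j\<bar> * (monom 1 (nat (t j)) * q_binomial (2 * L) (L - e - 4 * j)))"
proof -
  have "G N M \<alpha> \<beta> 4 = Sum_any (\<lambda>j. q_poly ((-1) ^ nat \<bar>j\<bar> *
      (monom 1 (nat (t j)) * q_binomial (2 * L) (L - e - 4 * j))))"
    unfolding G_def t(2) NM unfolding N(1) using t(1)
    by (simp add: q_poly_sign_mult q_poly_monom_mult mult.assoc)
  also have "\<dots> = (\<Sum>j\<in>{-L-1..L}. q_poly ((-1) ^ nat \<bar>j\<bar> *
      (monom 1 (nat (t j)) * q_binomial (2 * L) (L - e - 4 * j))))"
  proof (rule Sum_any.expand_superset)
    \<comment> \<open>The support in j lies well inside this interval, which is chosen to agree with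
      the alternating sums.\<close>
    have 0: "q_binomial (2 * L) (L - e - 4 * j) = 0" if "j \<notin> {-L-1..L}" for j
      using that N(2) L by (auto simp: q_binomial_def)
    show "{a. q_poly ((-1) ^ nat \<bar>a\<bar> * (monom 1 (nat (t a)) * q_binomial (2 * L) (L - e - 4 * a))) \<noteq> 0}
        \<subseteq> {-L-1..L}"
      by (intro subsetI, rule ccontr) (simp add: 0)
  qed simp
  finally show ?thesis by (simp add: q_poly_sum)
qed

lemma q_nonneg_G:
  assumes G: "0 \<le> L" "N + M = 2 * L" "N = L - e" "e \<in> {0, 1}" "\<And>j. 0 \<le> t j"
      "\<And>j. of_int 4 * of_int j * (((\<alpha> + \<beta>) * of_int j + (\<alpha> - \<beta>)) / 2) = (of_int (t j) :: rat)"
    and d: "0 \<le> d"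
    and eq: "\<And>q. 1 < q \<Longrightarrow> (\<Sum>j\<in>{-L-1..L}. (-1) powi j * q powi t j * qbin q (2 * L) (L - e - 4 * j))
      = (\<Sum>r\<in>{0..L}. T q e L r * RR q d r)"
  shows "q_nonneg (G N M \<alpha> \<beta> 4)"
proof -
  have "(\<Sum>j\<in>{-L-1..L}. (-1) ^ nat \<bar>j\<bar> * (monom 1 (nat (t j)) * q_binomial (2 * L) (L - e - 4 * j)))
    = (\<Sum>r\<in>{0..L}. T_poly e L r * RR_poly d r)"
  proof (rule poly_eqI_eval)
    fix x :: int assume x: "1 < x"
    have sgn: "(-1) ^ nat \<bar>j\<bar> = ((-1::real) powi j)" for j
      by (auto simp: power_int_def abs_if)
    have "real_of_int (poly (\<Sum>r\<in>{0..L}. T_poly e L r * RR_poly d r) x)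
      = (\<Sum>r\<in>{0..L}. T (real_of_int x) e L r * RR (real_of_int x) d r)"
      using x d G(4) by (auto simp: poly_sum eval_T_poly eval_RR_poly)
    then show "real_of_int (poly (\<Sum>j\<in>{-L-1..L}. (-1) ^ nat \<bar>j\<bar> *
        (monom 1 (nat (t j)) * q_binomial (2 * L) (L - e - 4 * j))) x)
      = real_of_int (poly (\<Sum>r\<in>{0..L}. T_poly e L r * RR_poly d r) x)"
      using eq[of "real_of_int x"] x G(5)
      by (simp add: poly_sum eval_q_binomial eval_monom_nat sgn mult.assoc)
  qed
  then have "G N M \<alpha> \<beta> 4 = q_poly (\<Sum>r\<in>{0..L}. T_poly e L r * RR_poly d r)"
    unfolding G_eq_q_poly[OF G] by (rule arg_cong)
  then show ?thesis
    using nonneg_coeffs_T_RR[of e L d] unfolding q_nonneg_def nonneg_coeffs_def by blast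
qed

section \<open>The three exponents and the conclusion\<close>

lemma of_int_tri: "(of_int (tri j) :: rat) = of_int j * (of_int j + 1) / 2"
proof -
  have "of_int (2 * tri j) = (of_int (j * (j + 1)) :: rat)" by (simp only: tri2)
  then show ?thesis by simp
qed

text \<open>Twice the exponent is j(21j + 1 + 2c), and 0 < 1 + 2c < 21 makes both factors agree in
  sign at every integer j.\<close>

lemma tri_quadratic_nonneg:
  assumes "0 \<le> c" "c \<le> 5"
  shows "0 \<le> tri j + 10 * j\<^sup>2 + c * j"
proof -
  have "2 * (tri j + 10 * j\<^sup>2 + c * j) = j * (21 * j + (1 + 2 * c))"
    using tri2[of j] by (simp add: algebra_simps power2_eq_square)
  moreover have "0 \<le> j * (21 * j + (1 + 2 * c))"
    using assms by (cases "0 \<le> j") (auto intro: mult_nonneg_nonneg mult_nonpos_nonpos)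
  ultimately have "0 \<le> 2 * (tri j + 10 * j\<^sup>2 + c * j)" by (simp only:)
  then show ?thesis by (simp only: zero_le_mult_iff) simp
qed

theorem mainTheorem13:
  shows "(\<forall>L::nat. q_nonneg (G (int L) (int L) (11/4) (5/2) 4)) \<and>
    (\<forall>L::int. L \<ge> 1 \<longrightarrow>
       q_nonneg (G (L - 1) (L + 1) 4 (5/4) 4) \<and>
       q_nonneg (G (L - 1) (L + 1) (15/4) (3/2) 4))"
proof (intro conjI allI impI)
  fix L :: nat
  show "q_nonneg (G (int L) (int L) (11/4) (5/2) 4)"
    \<comment> \<open>Here the sum of the parameters is 21/4 and their difference 1/4, so the
      exponent is j(21j+1)/2.\<close>
    by (rule q_nonneg_G[where e = 0 and d = 0 and t = "\<lambda>j. tri j + 10 * j\<^sup>2" and L = "int L"])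
      (use tri_quadratic_nonneg[of 0] alternating_sum_even in
        \<open>auto simp: of_int_tri algebra_simps power2_eq_square\<close>)
next
  fix L :: int assume L: "L \<ge> 1"
  show "q_nonneg (G (L - 1) (L + 1) 4 (5/4) 4)"
    \<comment> \<open>The sum is again 21/4; the difference 11/4 gives j(21j+11)/2, that is c =
      5.\<close>
    by (rule q_nonneg_G[where e = 1 and d = 1 and t = "\<lambda>j. tri j + 10 * j\<^sup>2 + (4 + 1) * j" and L = L])
      (use L tri_quadratic_nonneg[of 5] alternating_sum_odd[where d = 1 and L = L] in
        \<open>auto simp: of_int_tri field_simps power2_eq_square\<close>)
  show "q_nonneg (G (L - 1) (L + 1) (15/4) (3/2) 4)"
    \<comment> \<open>The difference 9/4 gives j(21j+9)/2, that is c = 4.\<close>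
    by (rule q_nonneg_G[where e = 1 and d = 0 and t = "\<lambda>j. tri j + 10 * j\<^sup>2 + (4 + 0) * j" and L = L])
      (use L tri_quadratic_nonneg[of 4] alternating_sum_odd[where d = 0 and L = L] in
        \<open>auto simp: of_int_tri field_simps power2_eq_square\<close>)
qed

end
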